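(* Let $\{G_i:i\in I\}$ be a set of compact Hausdorff Abelian topological groups and let $G=\prod_{i\in I}G_i$ with the product topology. Then $\bigoplus_{i\in I}G_i$ determines $G$.
   Context: All groups are Abelian. $\mathbb T$ is the circle group, $(-\tfrac12,\tfrac12]$ with addition mod $1$ and its usual compact metrizable topology. For a topological Abelian group $G$, $\widehat G$ is the group of continuous homomorphisms $G\to\mathbb T$ with the compact-open topology. A dense subgroup $D$ of $G$ determines $G$ if the restriction map $\widehat G\to\widehat D$, $h\mapsto h|D$ (which is always a continuous group isomorphism) is a homeomorphism. $\bigoplus_{i\in I}G_i$ is the subgroup of those $x\in\prod_{i\in I}G_i$ with $x_i\neq 0$ for only finitely many $i\in I$. *)

theory Defs
  imports "HOL-Analysis.Analysis" "HOL-Algebra.Product_Groups"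
begin

locale topological_abelian_group = comm_group G
  for G :: "('a, 'm) monoid_scheme" (structure) and T :: "'a topology" +
  assumes topspace_eq_carrier: "topspace T = carrier G"
    and continuous_mult: "continuous_map (prod_topology T T) T (\<lambda>(x, y). x \<otimes> y)"
    and continuous_inv: "continuous_map T T (\<lambda>x. inv x)"


text \<open>The representative of \<open>x\<close> modulo \<open>1\<close> in the interval \<open>(-1/2, 1/2]\<close>.\<close>

definition mod_one :: "real \<Rightarrow> real"
  where "mod_one x = x - of_int \<lceil>x - 1/2\<rceil>"

definition circle_group :: "real monoid"
  where "circle_group = \<lparr>carrier = {-1/2 <.. 1/2}, monoid.mult = (\<lambda>x y. mod_one (x + y)), one = 0\<rparr>"

text \<open>The topology transported from the unit circle in \<open>\<complex>\<close>; equivalently, the quotient topology of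
  \<open>\<real>/\<int>\<close>, see \<open>quotient_map_mod_one\<close> below. It is not the subspace topology of the interval,
  as the two ends are glued.\<close>

definition circle_topology :: "real topology"
  where "circle_topology = pullback_topology {-1/2 <.. 1/2} (\<lambda>x. cis (2 * pi * x)) euclidean"


text \<open>A character is undefined (extensional) outside the carrier, so that characters are equal iff
  they agree on the carrier.\<close>

definition dual_group :: "('a, 'm) monoid_scheme \<Rightarrow> 'a topology \<Rightarrow> ('a \<Rightarrow> real) monoid"
  where "dual_group G T =
    \<lparr>carrier = {h \<in> extensional (carrier G). h \<in> hom G circle_group \<and> continuous_map T circle_topology h},
     monoid.mult = (\<lambda>g h. \<lambda>x\<in>carrier G. g x \<otimes>\<^bsub>circle_group\<^esub> h x),
     one = (\<lambda>x\<in>carrier G. \<one>\<^bsub>circle_group\<^esub>)\<rparr>"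

text \<open>The compact-open topology.\<close>

definition dual_topology :: "('a, 'm) monoid_scheme \<Rightarrow> 'a topology \<Rightarrow> ('a \<Rightarrow> real) topology"
  where "dual_topology G T =
    topology_generated_by
      {{h \<in> carrier (dual_group G T). h ` K \<subseteq> U} | K U. compactin T K \<and> openin circle_topology U}"

definition determines :: "'a set \<Rightarrow> ('a, 'm) monoid_scheme \<Rightarrow> 'a topology \<Rightarrow> bool"
  where "determines D G T \<longleftrightarrow>
    subgroup D G \<and> T closure_of D = topspace T \<and>
    homeomorphic_map (dual_topology G T)
      (dual_topology (G\<lparr>carrier := D\<rparr>) (subtopology T D)) (\<lambda>h. restrict h D)"


lemma topspace_dual_topology [simp]: "topspace (dual_topology G T) = carrier (dual_group G T)"
proof -
  have "carrier (dual_group G T) \<in>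
      {{h \<in> carrier (dual_group G T). h ` K \<subseteq> U} | K U. compactin T K \<and> openin circle_topology U}"
    by (rule CollectI, rule exI[of _ "{}"], rule exI[of _ "{}"]) auto
  then show ?thesis
    unfolding dual_topology_def topology_generated_by_topspace by blast
qed

lemma mod_one_in: "mod_one x \<in> {-1/2 <.. 1/2}"
  unfolding mod_one_def greaterThanAtMost_iff by linarith

lemma mod_one_add_int [simp]: "mod_one (x + of_int n) = mod_one x"
proof -
  have "x + of_int n - 1/2 = (x - 1/2) + of_int n"
    by simp
  then show ?thesis
    unfolding mod_one_def by (simp only: ceiling_add_of_int of_int_add)
qed

lemma mod_one_diff_int [simp]: "mod_one (x - of_int n) = mod_one x"
  using mod_one_add_int[of x "- n"] by simp

lemma mod_one_id: "x \<in> {-1/2 <.. 1/2} \<Longrightarrow> mod_one x = x"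
proof -
  assume "x \<in> {-1/2 <.. 1/2}"
  then have "\<lceil>x - 1/2\<rceil> = 0"
    by (subst ceiling_eq_iff) auto
  then show ?thesis by (simp add: mod_one_def)
qed

lemma mod_one_mod_one_add [simp]:
  "mod_one (mod_one x + y) = mod_one (x + y)" "mod_one (y + mod_one x) = mod_one (y + x)"
proof -
  show *: "mod_one (mod_one x + y) = mod_one (x + y)" for y
    using mod_one_diff_int[of "x + y" "\<lceil>x - 1/2\<rceil>"]
    by (subst (2) mod_one_def) (simp add: algebra_simps)
  show "mod_one (y + mod_one x) = mod_one (y + x)"
    using *[of y] by (simp add: add.commute)
qed

lemma cis_mod_one [simp]: "cis (2 * pi * mod_one x) = cis (2 * pi * x)"
proof -
  have "cis (2 * pi * mod_one x) = cis (2 * pi * x) / cis (2 * pi * of_int \<lceil>x - 1/2\<rceil>)"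
    by (simp only: mod_one_def cis_divide right_diff_distrib)
  then show ?thesis by (simp add: cis_multiple_2pi)
qed

lemma comm_group_circle_group: "comm_group circle_group"
proof (rule comm_groupI)
  fix x assume x: "x \<in> carrier circle_group"
  have "mod_one (- x) \<in> carrier circle_group"
    using mod_one_in by (simp add: circle_group_def)
  moreover have "mod_one (- x) \<otimes>\<^bsub>circle_group\<^esub> x = \<one>\<^bsub>circle_group\<^esub>"
    by (simp add: circle_group_def mod_one_id)
  ultimately show "\<exists>y\<in>carrier circle_group. y \<otimes>\<^bsub>circle_group\<^esub> x = \<one>\<^bsub>circle_group\<^esub>"
    by blast
next
  fix x y assume "x \<in> carrier circle_group" "y \<in> carrier circle_group"
  show "x \<otimes>\<^bsub>circle_group\<^esub> y \<in> carrier circle_group"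
    using mod_one_in by (simp add: circle_group_def)
qed (auto simp: circle_group_def mod_one_id ac_simps)

lemma inv_circle_group: "x \<in> carrier circle_group \<Longrightarrow> inv\<^bsub>circle_group\<^esub> x = mod_one (- x)"
proof -
  interpret comm_group circle_group by (rule comm_group_circle_group)
  assume "x \<in> carrier circle_group"
  then show ?thesis
    by (intro inv_equality) (use mod_one_in in \<open>auto simp: circle_group_def mod_one_id\<close>)
qed

lemma topspace_circle_topology: "topspace circle_topology = carrier circle_group"
  by (simp add: circle_topology_def topspace_pullback_topology circle_group_def)

lemma continuous_map_cis_circle: "continuous_map circle_topology euclidean (\<lambda>x. cis (2 * pi * x))"
  unfolding circle_topology_def
  using continuous_map_pullback[OF continuous_map_id] by (simp add: o_def id_def)

lemma continuous_map_into_circle: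
  "continuous_map X circle_topology f \<longleftrightarrow>
    f ` topspace X \<subseteq> carrier circle_group \<and> continuous_map X euclidean (\<lambda>x. cis (2 * pi * f x))"
proof
  assume f: "continuous_map X circle_topology f"
  show "f ` topspace X \<subseteq> carrier circle_group \<and> continuous_map X euclidean (\<lambda>x. cis (2 * pi * f x))"
    using continuous_map_image_subset_topspace[OF f]
      continuous_map_compose[OF f continuous_map_cis_circle]
    by (simp add: topspace_circle_topology o_def)
next
  assume "f ` topspace X \<subseteq> carrier circle_group \<and> continuous_map X euclidean (\<lambda>x. cis (2 * pi * f x))"
  then show "continuous_map X circle_topology f"
    unfolding circle_topology_def
    by (intro continuous_map_pullback') (auto simp: o_def circle_group_def)
qed

lemma topological_abelian_group_circle: "topological_abelian_group circle_group circle_topology"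
proof -
  interpret comm_group circle_group by (rule comm_group_circle_group)
  show ?thesis
  proof
    show "topspace circle_topology = carrier circle_group"
      by (rule topspace_circle_topology)
    have fst: "continuous_map (prod_topology circle_topology circle_topology) euclidean
                 (\<lambda>p. cis (2 * pi * fst p))"
      and snd: "continuous_map (prod_topology circle_topology circle_topology) euclidean
                 (\<lambda>p. cis (2 * pi * snd p))"
      using continuous_map_compose[OF continuous_map_fst continuous_map_cis_circle]
        continuous_map_compose[OF continuous_map_snd continuous_map_cis_circle]
      by (auto simp: o_def)
    have "continuous_map (prod_topology circle_topology circle_topology) euclidean
            (\<lambda>p. cis (2 * pi * fst p) * cis (2 * pi * snd p))"
      using continuous_map_compose[OF continuous_map_pairedI[OF fst snd],
          of euclidean "\<lambda>(z, w). z * w"]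
      by (simp add: o_def euclidean_product_topology case_prod_unfold continuous_on_mult
          continuous_on_fst continuous_on_snd)
    then show "continuous_map (prod_topology circle_topology circle_topology) circle_topology
            (\<lambda>(x, y). x \<otimes>\<^bsub>circle_group\<^esub> y)"
      unfolding continuous_map_into_circle
      using mod_one_in
      by (auto simp: circle_group_def case_prod_unfold cis_mult distrib_left)
    have "continuous_map circle_topology euclidean (\<lambda>x. cnj (cis (2 * pi * x)))"
      using continuous_map_compose[OF continuous_map_cis_circle, of euclidean cnj]
      by (simp add: o_def continuous_on_cnj)
    then have "continuous_map circle_topology euclidean (\<lambda>x. cis (2 * pi * inv\<^bsub>circle_group\<^esub> x))"
      by (rule continuous_map_eq) (simp add: topspace_circle_topology inv_circle_group cis_cnj)
    then show "continuous_map circle_topology circle_topology (\<lambda>x. inv\<^bsub>circle_group\<^esub> x)"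
      unfolding continuous_map_into_circle
      by (auto simp: topspace_circle_topology)
  qed
qed

lemma Hausdorff_circle_topology: "Hausdorff_space circle_topology"
proof (rule Hausdorff_space_injective_preimage[OF _ continuous_map_cis_circle])
  show "inj_on (\<lambda>x. cis (2 * pi * x)) (topspace circle_topology)"
  proof (rule inj_onI)
    fix x y assume xy: "x \<in> topspace circle_topology" "y \<in> topspace circle_topology"
      and "cis (2 * pi * x) = cis (2 * pi * y)"
    then obtain n :: int where "2 * pi * x = 2 * pi * y + 2 * pi * of_int n"
      by (auto simp: complex_eq_iff dest!: sin_cos_eq_iff[THEN iffD1, OF conjI])
    then have "2 * pi * x = 2 * pi * (y + of_int n)"
      by (simp only: distrib_left)
    then have "x = y + of_int n"
      by simp
    then have "mod_one x = mod_one y"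
      by simp
    then show "x = y"
      using xy by (simp add: topspace_circle_topology circle_group_def mod_one_id)
  qed
qed (rule Hausdorff_space_euclidean)

lemma continuous_map_mod_one: "continuous_map euclideanreal circle_topology mod_one"
  unfolding continuous_map_into_circle using mod_one_in
  by (auto simp: circle_group_def intro!: continuous_intros)

lemma mod_one_image: "mod_one ` {-1/2..1/2} = topspace circle_topology"
proof
  show "mod_one ` {-1/2..1/2} \<subseteq> topspace circle_topology"
    using mod_one_in by (auto simp: topspace_circle_topology circle_group_def)
  show "topspace circle_topology \<subseteq> mod_one ` {-1/2..1/2}"
  proof
    fix x assume "x \<in> topspace circle_topology"
    then have x: "x \<in> {-1/2<..1/2}" by (simp add: topspace_circle_topology circle_group_def)
    then show "x \<in> mod_one ` {-1/2..1/2}"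
      by (intro image_eqI[of _ _ x]) (simp_all add: mod_one_id)
  qed
qed

lemma compact_circle_topology: "compact_space circle_topology"
  using image_compactin[of euclideanreal "{-1/2..1/2}", OF _ continuous_map_mod_one]
  unfolding mod_one_image compact_space_def by simp

lemma quotient_map_mod_one: "quotient_map euclideanreal circle_topology mod_one"
proof -
  let ?J = "{-1/2..1/2} :: real set"
  have q: "quotient_map (top_of_set ?J) circle_topology mod_one"
    using continuous_map_mod_one Hausdorff_circle_topology mod_one_image
    by (intro continuous_imp_quotient_map)
       (auto simp: continuous_map_from_subtopology compact_space_subtopology)
  have surj: "range mod_one = topspace circle_topology"
    using continuous_map_image_subset_topspace[OF continuous_map_mod_one]
    unfolding mod_one_image[symmetric] topspace_euclidean by blast
  have "openin circle_topology U"
    if U: "U \<subseteq> topspace circle_topology" and "open {x. mod_one x \<in> U}" for U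
  proof -
    have "{x \<in> topspace (top_of_set ?J). mod_one x \<in> U} = ?J \<inter> {x. mod_one x \<in> U}"
      by auto
    then have "openin (top_of_set ?J) {x \<in> topspace (top_of_set ?J). mod_one x \<in> U}"
      using that(2) by (simp only: openin_open_Int)
    then show ?thesis
      using q U unfolding quotient_map_def by blast
  qed
  moreover have "open {x. mod_one x \<in> U}" if "openin circle_topology U" for U
    using openin_continuous_map_preimage[OF continuous_map_mod_one that] by simp
  ultimately show ?thesis
    unfolding quotient_map_def using surj by auto
qed

end

theory Submission
  imports Defs
begin

text \<open>
  Two facts together give the result: restriction from the product \<open>P\<close> to the sum \<open>D\<close> is a bijection
  between the character groups, and both dual topologies are discrete.

  The discreteness rests on the circle having no small subgroups: a power sequence that stays within
  distance \<open>1/2\<close> of \<open>1\<close> is constantly \<open>1\<close> (\<open>power_near_one_imp_one\<close>). Hence two characters that are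
  uniformly close on a subgroup are equal there. So if a compact set \<open>K\<close> contains
  subgroups which together generate the group, a character is isolated in the compact-open topology,
  by finitely many conditions on compact pieces of \<open>K\<close> (\<open>dual_topology_eq_discrete\<close>). For the
  product, which is compact by Tychonoff's theorem, \<open>K\<close> is the whole group. For the sum, \<open>K\<close> is the
  union of the coordinate axes, the set of points with at most one nontrivial coordinate. It is
  defined by closed conditions, so it is compact in the product; it lies inside \<open>D\<close>, and the axes
  generate \<open>D\<close>.

  Density of \<open>D\<close> makes restriction injective. It is surjective because, again by the absence of small
  subgroups, the kernel of a character \<open>h\<close> of \<open>D\<close> contains all points of \<open>D\<close> that vanish on a suitable
  finite set \<open>F\<close> of coordinates. Thus \<open>h\<close> factors through the projection that keeps the coordinates
  in \<open>F\<close> and replaces all others by the identity; this projection is continuous from \<open>P\<close> to \<open>D\<close>, so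
  composing \<open>h\<close> with it extends \<open>h\<close> to \<open>P\<close>.
\<close>

section \<open>The circle has no small subgroups\<close>

abbreviation circle_embed :: "real \<Rightarrow> complex"
  where "circle_embed t \<equiv> cis (2 * pi * t)"

text \<open>Squaring multiplies the distance to \<open>1\<close> by \<open>norm (v + 1)\<close>, which is at least \<open>3/2\<close> near \<open>1\<close>. If
  all powers stayed near \<open>1\<close> with \<open>w \<noteq> 1\<close>, repeated squaring would drive the distance beyond every
  bound.\<close>

lemma power_near_one_imp_one:
  fixes w :: complex
  assumes near: "\<And>n. norm (w ^ n - 1) \<le> 1/2"
  shows "w = 1"
proof (rule ccontr)
  assume "w \<noteq> 1"
  have growth: "(3/2) ^ n * norm (w - 1) \<le> norm (w ^ (2 ^ n) - 1)" for n
  proof (induction n)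
    case (Suc n)
    let ?v = "w ^ (2 ^ n)"
    have "2 \<le> norm (?v + 1) + norm (?v - 1)"
      using norm_triangle_ineq4[of "?v + 1" "?v - 1"] by simp
    then have "3/2 \<le> norm (?v + 1)"
      using near[of "2 ^ n"] by linarith
    then have "3/2 * norm (?v - 1) \<le> norm (?v + 1) * norm (?v - 1)"
      by (intro mult_right_mono) auto
    also have "\<dots> = norm (w ^ (2 ^ Suc n) - 1)"
      by (simp add: norm_mult[symmetric] algebra_simps power_add[symmetric] mult_2)
    finally show ?case
      using Suc.IH by simp
  qed simp
  obtain n where "1 / norm (w - 1) < (3/2) ^ n"
    using real_arch_pow[of "3/2"] by auto
  then have "1 < (3/2) ^ n * norm (w - 1)"
    using \<open>w \<noteq> 1\<close> by (simp add: field_simps)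
  then show False
    using growth[of n] near[of "2 ^ n"] by linarith
qed

lemma circle_embed_inject:
  assumes "s \<in> carrier circle_group" "t \<in> carrier circle_group"
    and "circle_embed s = circle_embed t"
  shows "s = t"
proof -
  have "cis (2 * pi * s) / cis (2 * pi * t) = 1"
    using assms(3) by simp
  then have "cis (2 * pi * (s - t)) = 1"
    by (simp only: cis_divide right_diff_distrib)
  then have "cos (2 * pi * (s - t)) = 1"
    by (simp add: complex_eq_iff)
  then obtain n :: int where "2 * pi * (s - t) = of_int n * 2 * pi"
    by (auto simp: cos_one_2pi_int)
  then have "s - t = of_int n"
    by simp
  then have "mod_one s = mod_one t"
    using mod_one_add_int[of t n] by (simp add: algebra_simps)
  then show ?thesis
    using assms(1,2) by (simp add: circle_group_def mod_one_id)
qed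

lemma circle_embed_hom_mult:
  assumes "h \<in> hom A circle_group" "x \<in> carrier A" "y \<in> carrier A"
  shows "circle_embed (h (x \<otimes>\<^bsub>A\<^esub> y)) = circle_embed (h x) * circle_embed (h y)"
  using assms by (simp add: hom_mult circle_group_def cis_mult distrib_left)

lemma circle_embed_hom_pow:
  assumes "group A" "h \<in> hom A circle_group" "x \<in> carrier A"
  shows "circle_embed (h (x [^]\<^bsub>A\<^esub> (n::nat))) = circle_embed (h x) ^ n"
proof (induction n)
  case 0
  have "h \<one>\<^bsub>A\<^esub> = \<one>\<^bsub>circle_group\<^esub>"
    using assms comm_group_circle_group by (simp add: hom_one comm_group_def)
  then show ?case
    by (simp add: circle_group_def)
next
  case (Suc n)
  interpret group A by fact
  show ?case
    using assms Suc.IH by (simp add: circle_embed_hom_mult)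
qed

text \<open>The quotients \<open>h x / g x\<close> form a subgroup of the unit circle, which closeness keeps near \<open>1\<close>.\<close>

lemma homs_to_circle_eq_on_subgroup:
  assumes "group A" "subgroup S A" "g \<in> hom A circle_group" "h \<in> hom A circle_group"
    and close: "\<And>x. x \<in> S \<Longrightarrow> norm (circle_embed (h x) - circle_embed (g x)) \<le> 1/2"
    and "x \<in> S"
  shows "h x = g x"
proof -
  interpret group A by fact
  interpret S: subgroup S A by fact
  have x: "x \<in> carrier A"
    using \<open>x \<in> S\<close> by (rule S.mem_carrier)
  let ?w = "circle_embed (h x) / circle_embed (g x)"
  have "norm (?w ^ n - 1) \<le> 1/2" for n :: nat
  proof -
    have "x [^]\<^bsub>A\<^esub> n \<in> S"
      using \<open>x \<in> S\<close> by (induction n) auto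
    from close[OF this]
    have "norm (circle_embed (h x) ^ n - circle_embed (g x) ^ n) \<le> 1/2"
      using assms x by (simp add: circle_embed_hom_pow)
    also have "circle_embed (h x) ^ n - circle_embed (g x) ^ n = (?w ^ n - 1) * circle_embed (g x) ^ n"
      by (simp add: power_divide left_diff_distrib)
    finally show ?thesis
      by (simp add: norm_mult norm_power)
  qed
  then have "?w = 1"
    by (rule power_near_one_imp_one)
  then show ?thesis
    using assms x by (intro circle_embed_inject) (auto simp: hom_in_carrier)
qed

section \<open>A criterion for the dual to be discrete\<close>

lemma homs_eq_on_generate:
  assumes "group A" "group B" "g \<in> hom A B" "h \<in> hom A B" "X \<subseteq> carrier A"
    and eq: "\<And>x. x \<in> X \<Longrightarrow> h x = g x" and "x \<in> generate A X"
  shows "h x = g x"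
proof -
  interpret g: group_hom A B g
    using assms by (simp add: group_hom_def group_hom_axioms_def)
  interpret h: group_hom A B h
    using assms by (simp add: group_hom_def group_hom_axioms_def)
  show ?thesis
    using \<open>x \<in> generate A X\<close>
  proof induction
    case one
    show ?case by simp
  next
    case (incl x)
    then show ?case by (rule eq)
  next
    case (inv x)
    then have "x \<in> carrier A" using assms(5) by blast
    then show ?case using eq[OF inv] by simp
  next
    case (eng x y)
    then have "x \<in> carrier A" "y \<in> carrier A"
      using group.generate_in_carrier[OF assms(1,5)] by auto
    then show ?case using eng by simp
  qed
qed

text \<open>Cut \<open>K\<close> into finitely many compact pieces on each of which the character \<open>g\<close> varies little, and
  consider the characters that send each piece into a slightly larger disc. They form an open
  neighbourhood of \<open>g\<close>, all of whose members are close to \<open>g\<close> on \<open>K\<close>, hence equal to \<open>g\<close> on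
  the subgroups in \<open>\<S>\<close> and on everything these generate.

  Asking for several subgroups inside \<open>K\<close>, rather than for a compact group, is what makes the
  criterion apply to direct sums, which are not compact in general.\<close>

lemma dual_topology_eq_discrete:
  assumes "group A" and T: "topspace T = carrier A"
    and K: "compactin T K"
    and sub: "\<And>S. S \<in> \<S> \<Longrightarrow> subgroup S A \<and> S \<subseteq> K"
    and gen: "carrier A \<subseteq> generate A (\<Union>\<S>)"
  shows "dual_topology A T = discrete_topology (carrier (dual_group A T))"
proof -
  have circle_is_group: "group circle_group"
    using comm_group_circle_group by (rule comm_group.axioms(2))
  have gens: "\<Union>\<S> \<subseteq> carrier A"
    using sub subgroup.subset by blast
  have "openin (dual_topology A T) {g}" if g: "g \<in> carrier (dual_group A T)" for g
  proof -
    \<comment> \<open>The radii \<open>1/8\<close> for the pieces and \<open>1/4\<close> for their targets add up to less than \<open>1/2\<close>, the bound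
      in \<open>homs_to_circle_eq_on_subgroup\<close>.\<close>
    have "compact (sphere (0::complex) 1)"
      by simp
    then obtain Z :: "complex set" where Z: "finite Z" "sphere 0 1 \<subseteq> (\<Union>z\<in>Z. ball z (1/8))"
      unfolding compact_eq_totally_bounded by (metis zero_less_divide_1_iff zero_less_numeral)
    define K' where "K' z = {x \<in> topspace T. circle_embed (g x) \<in> cball z (1/8)} \<inter> K" for z
    define U where "U z = {t \<in> topspace circle_topology. circle_embed t \<in> ball z (1/4)}" for z
    define N where "N z = {h \<in> carrier (dual_group A T). h ` K' z \<subseteq> U z}" for z
    have g_hom: "g \<in> hom A circle_group" and g_cont: "continuous_map T circle_topology g"
      using g by (auto simp: dual_group_def)
    have "compactin T (K' z)" for z
      unfolding K'_def using continuous_map_compose[OF g_cont continuous_map_cis_circle]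
      by (intro closed_Int_compactin[OF _ K] closedin_continuous_map_preimage) (auto simp: o_def)
    moreover have "openin circle_topology (U z)" for z
      unfolding U_def
      by (rule openin_continuous_map_preimage[OF continuous_map_cis_circle]) simp
    ultimately have "openin (dual_topology A T) (N z)" for z
      unfolding dual_topology_def N_def by (intro topology_generated_by_Basis) blast
    then have "openin (dual_topology A T) ((\<Inter>z\<in>Z. N z) \<inter> topspace (dual_topology A T))"
      using Z(1) by (intro openin_INT)
    moreover have "(\<Inter>z\<in>Z. N z) \<inter> topspace (dual_topology A T) = {g}"
    proof (intro equalityI subsetI)
      fix h assume "h \<in> (\<Inter>z\<in>Z. N z) \<inter> topspace (dual_topology A T)"
      then have h: "h \<in> carrier (dual_group A T)" and hN: "\<And>z. z \<in> Z \<Longrightarrow> h \<in> N z"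
        by auto
      then have h_hom: "h \<in> hom A circle_group"
        by (auto simp: dual_group_def)
      have close: "norm (circle_embed (h x) - circle_embed (g x)) \<le> 1/2" if "x \<in> K" for x
      proof -
        have "circle_embed (g x) \<in> (\<Union>z\<in>Z. ball z (1/8))"
          by (rule subsetD[OF Z(2)]) simp
        then obtain z where z: "z \<in> Z" "dist z (circle_embed (g x)) < 1/8"
          by (elim UN_E) (simp only: mem_ball)
        then have "x \<in> K' z"
          using compactin_subset_topspace[OF K] that by (auto simp: K'_def)
        then have "dist z (circle_embed (h x)) < 1/4"
          using hN[OF z(1)] by (auto simp: N_def U_def)
        then show ?thesis
          using z(2) dist_triangle3[of "circle_embed (h x)" "circle_embed (g x)" z]
          by (simp add: dist_norm)
      qed
      have "h x = g x" if "x \<in> \<Union>\<S>" for x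
      proof -
        from that obtain S where S: "S \<in> \<S>" "x \<in> S" by blast
        show ?thesis
        proof (rule homs_to_circle_eq_on_subgroup[OF \<open>group A\<close> _ g_hom h_hom _ S(2)])
          show "subgroup S A" using sub S(1) by blast
          show "norm (circle_embed (h y) - circle_embed (g y)) \<le> 1/2" if "y \<in> S" for y
            using close sub S(1) that by blast
        qed
      qed
      then have eq: "h x = g x" if "x \<in> carrier A" for x
        by (rule homs_eq_on_generate[OF \<open>group A\<close> circle_is_group g_hom h_hom gens])
           (use gen that in blast)+
      have "h \<in> extensional (carrier A)" "g \<in> extensional (carrier A)"
        using h g by (auto simp: dual_group_def)
      then have "h = g"
        by (rule extensionalityI) (rule eq)
      then show "h \<in> {g}"
        by simp
    next
      fix h assume h: "h \<in> {g}"
      have "g x \<in> U z" if "x \<in> K' z" for x z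
        using that funcset_mem[OF continuous_map_funspace[OF g_cont], of x]
        by (simp add: K'_def U_def)
      then have "g \<in> N z" for z
        using g by (auto simp: N_def)
      then show "h \<in> (\<Inter>z\<in>Z. N z) \<inter> topspace (dual_topology A T)"
        using h g by auto
    qed
    ultimately show ?thesis
      by simp
  qed
  then show ?thesis
    by (metis discrete_topology_unique topspace_dual_topology)
qed

section \<open>Truncating points of a product to a set of coordinates\<close>

definition truncate_to :: "'i set \<Rightarrow> ('i \<Rightarrow> ('a, 'm) monoid_scheme) \<Rightarrow> 'i set \<Rightarrow> ('i \<Rightarrow> 'a) \<Rightarrow> 'i \<Rightarrow> 'a"
  where "truncate_to I G F x = (\<lambda>i\<in>I. if i \<in> F then x i else \<one>\<^bsub>G i\<^esub>)"

context
  fixes I :: "'i set" and G :: "'i \<Rightarrow> ('a, 'm) monoid_scheme"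
  assumes G: "\<And>i. i \<in> I \<Longrightarrow> group (G i)"
begin

lemma truncate_to_in_product:
  "x \<in> carrier (product_group I G) \<Longrightarrow> truncate_to I G F x \<in> carrier (product_group I G)"
  using G by (auto simp: truncate_to_def PiE_iff group.is_monoid monoid.one_closed)

lemma truncate_to_in_sum:
  assumes "x \<in> carrier (product_group I G)" "finite F"
  shows "truncate_to I G F x \<in> carrier (sum_group I G)"
proof -
  have "{i \<in> I. truncate_to I G F x i \<noteq> \<one>\<^bsub>G i\<^esub>} \<subseteq> F"
    by (auto simp: truncate_to_def)
  then show ?thesis
    using truncate_to_in_product[OF assms(1), of F] finite_subset[OF _ assms(2)]
    by (simp add: carrier_sum_group[OF G])
qed

lemma truncate_to_preserves_sum:
  assumes "x \<in> carrier (sum_group I G)"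
  shows "truncate_to I G F x \<in> carrier (sum_group I G)"
proof -
  have "{i \<in> I. truncate_to I G F x i \<noteq> \<one>\<^bsub>G i\<^esub>} \<subseteq> {i \<in> I. x i \<noteq> \<one>\<^bsub>G i\<^esub>}"
    by (auto simp: truncate_to_def)
  then show ?thesis
    using assms truncate_to_in_product[of x F] finite_subset
    by (auto simp: carrier_sum_group[OF G])
qed

lemma truncate_to_hom: "truncate_to I G F \<in> hom (product_group I G) (product_group I G)"
proof (rule homI)
  fix x y assume "x \<in> carrier (product_group I G)" "y \<in> carrier (product_group I G)"
  then show "truncate_to I G F (x \<otimes>\<^bsub>product_group I G\<^esub> y) =
      truncate_to I G F x \<otimes>\<^bsub>product_group I G\<^esub> truncate_to I G F y"
    using G by (auto simp: truncate_to_def fun_eq_iff group.is_monoid)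
qed (rule truncate_to_in_product)

lemma truncate_to_Un:
  assumes "x \<in> carrier (product_group I G)" "F \<inter> F' = {}"
  shows "truncate_to I G (F \<union> F') x =
    truncate_to I G F x \<otimes>\<^bsub>product_group I G\<^esub> truncate_to I G F' x"
  using assms G by (auto simp: truncate_to_def fun_eq_iff PiE_iff group.is_monoid)

lemma truncate_to_eq_self:
  assumes "x \<in> carrier (product_group I G)" "\<And>i. i \<in> I - F \<Longrightarrow> x i = \<one>\<^bsub>G i\<^esub>"
  shows "truncate_to I G F x = x"
  using assms by (auto simp: truncate_to_def fun_eq_iff PiE_iff extensional_def)

lemma continuous_map_truncate_to:
  assumes "\<And>i. i \<in> I \<Longrightarrow> topspace (T i) = carrier (G i)"
  shows "continuous_map (product_topology T I) (product_topology T I) (truncate_to I G F)"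
  unfolding continuous_map_componentwise
proof (intro conjI ballI)
  fix k assume k: "k \<in> I"
  show "continuous_map (product_topology T I) (T k) (\<lambda>x. truncate_to I G F x k)"
    using k assms[OF k] G[OF k] continuous_map_product_projection[OF k, of T]
    by (cases "k \<in> F") (auto simp: truncate_to_def group.is_monoid monoid.one_closed)
qed (auto simp: truncate_to_def)

section \<open>The direct sum inside the product\<close>

text \<open>A basic open neighbourhood of \<open>x\<close> restricts only finitely many coordinates, so it contains the
  truncation of \<open>x\<close> to these.\<close>

lemma sum_group_dense:
  assumes T: "\<And>i. i \<in> I \<Longrightarrow> topspace (T i) = carrier (G i)"
  shows "product_topology T I closure_of carrier (sum_group I G) = topspace (product_topology T I)"
proof (intro equalityI closure_of_subset_topspace subsetI)
  fix x assume x: "x \<in> topspace (product_topology T I)"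
  then have xP: "x \<in> carrier (product_group I G)"
    using T by (auto simp: PiE_iff)
  have "\<exists>y. y \<in> carrier (sum_group I G) \<and> y \<in> W"
    if W: "x \<in> W" "openin (product_topology T I) W" for W
  proof -
    obtain U where U: "finite {i \<in> I. U i \<noteq> topspace (T i)}" "x \<in> Pi\<^sub>E I U" "Pi\<^sub>E I U \<subseteq> W"
      using W unfolding openin_product_topology_alt by metis
    let ?y = "truncate_to I G {i \<in> I. U i \<noteq> topspace (T i)} x"
    have "?y \<in> Pi\<^sub>E I U"
      using U(2) T G by (auto simp: truncate_to_def PiE_iff group.is_monoid monoid.one_closed)
    then show ?thesis
      using truncate_to_in_sum[OF xP U(1)] U(3) by blast
  qed
  then show "x \<in> product_topology T I closure_of carrier (sum_group I G)"
    using x by (auto simp: in_closure_of)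
qed

lemma subgroup_sum_group_product: "subgroup (carrier (sum_group I G)) (product_group I G)"
  using subgroup_sum_group[OF G] by (simp add: carrier_sum_group[OF G])

lemma subgroup_truncated:
  "subgroup {x \<in> carrier (product_group I G). \<forall>i\<in>I - F. x i = \<one>\<^bsub>G i\<^esub>} (product_group I G)"
proof -
  \<comment> \<open>The set is itself a product of subgroups.\<close>
  have "{x \<in> carrier (product_group I G). \<forall>i\<in>I - F. x i = \<one>\<^bsub>G i\<^esub>} =
      (\<Pi>\<^sub>E i\<in>I. if i \<in> F then carrier (G i) else {\<one>\<^bsub>G i\<^esub>})"
    (is "?L = ?R")
  proof (intro equalityI subsetI)
    fix x assume x: "x \<in> ?R"
    have "x i \<in> carrier (G i) \<and> (i \<notin> F \<longrightarrow> x i = \<one>\<^bsub>G i\<^esub>)" if "i \<in> I" for i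
      using PiE_mem[OF x that] G[OF that]
      by (auto simp: group.is_monoid monoid.one_closed split: if_splits)
    then show "x \<in> ?L"
      using x by (auto simp: PiE_iff)
  qed (auto simp: PiE_iff)
  moreover have "subgroup (\<Pi>\<^sub>E i\<in>I. if i \<in> F then carrier (G i) else {\<one>\<^bsub>G i\<^esub>}) (product_group I G)"
    using G by (auto simp: PiE_subgroup_product_group group.subgroup_self group.triv_subgroup)
  ultimately show ?thesis
    by simp
qed

text \<open>A point of finite support is the product of its single coordinates, by induction on the support
  with \<open>truncate_to\<close> splitting off one coordinate at a time.\<close>

lemma sum_group_generated_by_factors:
  "carrier (sum_group I G) \<subseteq> generate (product_group I G)
    (\<Union>i\<in>I. {x \<in> carrier (product_group I G). \<forall>j\<in>I - {i}. x j = \<one>\<^bsub>G j\<^esub>})"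
  (is "_ \<subseteq> generate ?P ?X")
proof
  fix x assume x: "x \<in> carrier (sum_group I G)"
  then have xP: "x \<in> carrier ?P" and fin: "finite {i \<in> I. x i \<noteq> \<one>\<^bsub>G i\<^esub>}"
    by (auto simp: carrier_sum_group[OF G])
  have "truncate_to I G F x \<in> generate ?P ?X" if "finite F" "F \<subseteq> I" for F
    using that
  proof induction
    case empty
    have "truncate_to I G {} x = \<one>\<^bsub>?P\<^esub>"
      by (simp add: truncate_to_def)
    then show ?case
      by (simp only: generate.one)
  next
    case (insert i F)
    have "truncate_to I G {i} x \<in> ?X"
      using insert.prems truncate_to_in_product[OF xP, of "{i}"]
      by (intro UN_I[of i]) (auto simp: truncate_to_def)
    moreover have "truncate_to I G (insert i F) x =
        truncate_to I G {i} x \<otimes>\<^bsub>?P\<^esub> truncate_to I G F x"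
      using truncate_to_Un[OF xP, of "{i}" F] insert.hyps by simp
    ultimately show ?case
      using insert by (simp only: generate.eng generate.incl insert_subset)
  qed
  from this[OF fin] have "truncate_to I G {i \<in> I. x i \<noteq> \<one>\<^bsub>G i\<^esub>} x \<in> generate ?P ?X"
    by blast
  then show "x \<in> generate ?P ?X"
    using truncate_to_eq_self[OF xP, of "{i \<in> I. x i \<noteq> \<one>\<^bsub>G i\<^esub>}"] by simp
qed

text \<open>The formulation with pairs of coordinates exhibits the union of the coordinate axes as an
  intersection of closed sets of a compact space. This is where the factors have to be Hausdorff: the
  sets on which a given coordinate is trivial must be closed.\<close>

lemma compactin_union_of_factors:
  assumes T: "\<And>i. i \<in> I \<Longrightarrow> topspace (T i) = carrier (G i)"
    and comp: "\<And>i. i \<in> I \<Longrightarrow> compact_space (T i)"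
    and Haus: "\<And>i. i \<in> I \<Longrightarrow> Hausdorff_space (T i)"
  shows "compactin (product_topology T I)
    {x \<in> carrier (product_group I G). \<forall>i\<in>I. \<forall>j\<in>I. i = j \<or> x i = \<one>\<^bsub>G i\<^esub> \<or> x j = \<one>\<^bsub>G j\<^esub>}"
    (is "compactin ?T ?K")
proof (rule closedin_compact_space)
  show "compact_space ?T"
    using comp by (simp add: compact_space_product_topology)
  have top: "topspace ?T = carrier (product_group I G)"
    using T by (auto simp: PiE_iff)
  have cl: "closedin ?T {x \<in> topspace ?T. x i = \<one>\<^bsub>G i\<^esub>}" if i: "i \<in> I" for i
  proof -
    have "closedin (T i) {\<one>\<^bsub>G i\<^esub>}"
      using Haus[OF i] T[OF i] G[OF i]
      by (simp add: closedin_Hausdorff_sing_eq group.is_monoid monoid.one_closed)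
    from closedin_continuous_map_preimage[OF continuous_map_product_projection[OF i, of T] this]
    show ?thesis by simp
  qed
  have "closedin ?T (\<Inter>(insert (topspace ?T)
      {{x \<in> topspace ?T. x i = \<one>\<^bsub>G i\<^esub>} \<union> {x \<in> topspace ?T. x j = \<one>\<^bsub>G j\<^esub>} | i j.
        i \<in> I \<and> j \<in> I \<and> i \<noteq> j}))"
    by (rule closedin_Inter, blast)
       (elim insertE CollectE exE conjE, simp_all only: closedin_topspace closedin_Un cl)
  also have "\<Inter>(insert (topspace ?T)
      {{x \<in> topspace ?T. x i = \<one>\<^bsub>G i\<^esub>} \<union> {x \<in> topspace ?T. x j = \<one>\<^bsub>G j\<^esub>} | i j.
        i \<in> I \<and> j \<in> I \<and> i \<noteq> j}) = ?K"
    unfolding top by blast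
  finally show "closedin ?T ?K" .
qed

lemma union_of_factors_subset_sum:
  "{x \<in> carrier (product_group I G). \<forall>i\<in>I. \<forall>j\<in>I. i = j \<or> x i = \<one>\<^bsub>G i\<^esub> \<or> x j = \<one>\<^bsub>G j\<^esub>}
    \<subseteq> carrier (sum_group I G)"
proof
  fix x
  assume x: "x \<in> {x \<in> carrier (product_group I G).
      \<forall>i\<in>I. \<forall>j\<in>I. i = j \<or> x i = \<one>\<^bsub>G i\<^esub> \<or> x j = \<one>\<^bsub>G j\<^esub>}"
  have "\<exists>k. {i \<in> I. x i \<noteq> \<one>\<^bsub>G i\<^esub>} \<subseteq> {k}"
    using x by blast
  then have "finite {i \<in> I. x i \<noteq> \<one>\<^bsub>G i\<^esub>}"
    using finite_subset by blast
  then show "x \<in> carrier (sum_group I G)"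
    using x by (auto simp: carrier_sum_group[OF G])
qed

section \<open>Characters of the direct sum\<close>

text \<open>The discreteness criterion applies with the coordinate axes as generating subgroups. The
  compact set is that of the points with at most one nontrivial coordinate; it is the union
  of the axes, together with the identity in case \<open>I\<close> is empty.\<close>

lemma dual_topology_sum_group_discrete:
  fixes T :: "'i \<Rightarrow> 'a topology"
  assumes T: "\<And>i. i \<in> I \<Longrightarrow> topspace (T i) = carrier (G i)"
    and comp: "\<And>i. i \<in> I \<Longrightarrow> compact_space (T i)"
    and Haus: "\<And>i. i \<in> I \<Longrightarrow> Hausdorff_space (T i)"
  defines "D \<equiv> carrier (sum_group I G)"
  defines "A \<equiv> (product_group I G)\<lparr>carrier := D\<rparr>"
  shows "dual_topology A (subtopology (product_topology T I) D) =
    discrete_topology (carrier (dual_group A (subtopology (product_topology T I) D)))"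
proof -
  interpret P: group "product_group I G"
    using G by simp
  have D: "subgroup D (product_group I G)"
    unfolding D_def by (rule subgroup_sum_group_product)
  let ?K = "{x \<in> carrier (product_group I G).
    \<forall>i\<in>I. \<forall>j\<in>I. i = j \<or> x i = \<one>\<^bsub>G i\<^esub> \<or> x j = \<one>\<^bsub>G j\<^esub>}"
  let ?factor = "\<lambda>i. {x \<in> carrier (product_group I G). \<forall>j\<in>I - {i}. x j = \<one>\<^bsub>G j\<^esub>}"
  have KD: "?K \<subseteq> D"
    unfolding D_def by (rule union_of_factors_subset_sum)
  have factor_K: "?factor i \<subseteq> ?K" for i
    by blast
  have "group A"
    unfolding A_def using D by (rule P.subgroup_imp_group)
  moreover have "topspace (subtopology (product_topology T I) D) = carrier A"
    using subgroup.subset[OF D] T by (auto simp: A_def PiE_iff)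
  moreover have "compactin (subtopology (product_topology T I) D) ?K"
    unfolding compactin_subtopology
    using compactin_union_of_factors[OF T comp Haus] KD by blast
  moreover have "subgroup S A \<and> S \<subseteq> ?K" if "S \<in> ?factor ` I" for S
  proof -
    from that obtain i where S: "S = ?factor i"
      by blast
    have "S \<subseteq> ?K"
      unfolding S by (rule factor_K)
    moreover have "subgroup S (product_group I G)"
      unfolding S by (rule subgroup_truncated)
    ultimately show ?thesis
      unfolding A_def by (intro conjI P.subgroup_incl D subset_trans[OF _ KD])
  qed
  moreover have "(\<Union>(?factor ` I)) \<subseteq> D"
    by (intro UN_least subset_trans[OF factor_K KD])
  then have "generate A (\<Union>(?factor ` I)) = generate (product_group I G) (\<Union>(?factor ` I))"
    unfolding A_def by (rule P.generate_consistent[OF _ D])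
  then have "carrier A \<subseteq> generate A (\<Union>(?factor ` I))"
    using sum_group_generated_by_factors by (simp add: A_def D_def)
  ultimately show ?thesis
    by (rule dual_topology_eq_discrete[where \<S> = "?factor ` I"])
qed

text \<open>By continuity, \<open>h\<close> is close to \<open>0\<close> on the intersection of \<open>D\<close> with a basic neighbourhood of the
  identity. This contains the subgroup \<open>S\<close> of all points of \<open>D\<close> whose coordinates in some finite set
  \<open>F\<close> are trivial, and so \<open>h\<close> vanishes on \<open>S\<close>. Truncation to \<open>F\<close> changes a point only by an
  element of \<open>S\<close>.\<close>

lemma character_of_sum_depends_on_finitely_many:
  fixes T :: "'i \<Rightarrow> 'a topology"
  defines "D \<equiv> carrier (sum_group I G)"
  assumes T: "\<And>i. i \<in> I \<Longrightarrow> topspace (T i) = carrier (G i)"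
    and h: "h \<in> hom ((product_group I G)\<lparr>carrier := D\<rparr>) circle_group"
    and cont: "continuous_map (subtopology (product_topology T I) D) circle_topology h"
  obtains F where "finite F" "\<And>x. x \<in> D \<Longrightarrow> h (truncate_to I G F x) = h x"
proof -
  let ?P = "product_group I G"
  let ?A = "?P\<lparr>carrier := D\<rparr>"
  interpret P: group ?P
    using G by simp
  have D: "subgroup D ?P"
    unfolding D_def by (rule subgroup_sum_group_product)
  interpret A: group ?A
    using D by (rule P.subgroup_imp_group)
  interpret C: comm_group circle_group
    by (rule comm_group_circle_group)
  have DP: "D \<subseteq> carrier ?P"
    using D by (rule subgroup.subset)
  have oneD: "\<one>\<^bsub>?P\<^esub> \<in> D"
    using D by (rule subgroup.one_closed)
  have h_one: "h \<one>\<^bsub>?P\<^esub> = 0"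
    using hom_one[OF h A.group_axioms C.group_axioms] by (simp add: circle_group_def)
  have DT: "topspace (subtopology (product_topology T I) D) = D"
    using DP T by (auto simp: PiE_iff)
  have "openin (subtopology (product_topology T I) D)
      {x \<in> topspace (subtopology (product_topology T I) D). circle_embed (h x) \<in> ball 1 (1/2)}"
    using continuous_map_compose[OF cont continuous_map_cis_circle]
    by (intro openin_continuous_map_preimage) (auto simp: o_def)
  then obtain W where W: "openin (product_topology T I) W"
    and DW: "{x \<in> D. circle_embed (h x) \<in> ball 1 (1/2)} = W \<inter> D"
    unfolding openin_subtopology DT by blast
  have "\<one>\<^bsub>?P\<^esub> \<in> {x \<in> D. circle_embed (h x) \<in> ball 1 (1/2)}"
    using oneD h_one by simp
  then have "\<one>\<^bsub>?P\<^esub> \<in> W"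
    unfolding DW by blast
  then obtain U where U: "finite {i \<in> I. U i \<noteq> topspace (T i)}" "\<one>\<^bsub>?P\<^esub> \<in> Pi\<^sub>E I U" "Pi\<^sub>E I U \<subseteq> W"
    using W unfolding openin_product_topology_alt by metis
  define F where "F = {i \<in> I. U i \<noteq> topspace (T i)}"
  \<comment> \<open>Points may be nontrivial only outside \<open>F\<close>, whence the double complement in the instance of
    \<open>subgroup_truncated\<close>.\<close>
  define S where "S = {x \<in> carrier ?P. \<forall>i\<in>I - - F. x i = \<one>\<^bsub>G i\<^esub>} \<inter> D"
  have S: "subgroup S ?A"
    unfolding S_def
    using P.subgroup_incl[OF P.subgroups_Inter_pair[OF subgroup_truncated[of "- F"] D] D] by simp
  have near: "norm (circle_embed (h x) - circle_embed 0) \<le> 1/2" if "x \<in> S" for x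
  proof -
    have "x i \<in> U i" if "i \<in> I" for i
      using \<open>x \<in> S\<close> U(2) T that by (cases "i \<in> F") (auto simp: S_def F_def PiE_iff)
    then have "x \<in> Pi\<^sub>E I U"
      using \<open>x \<in> S\<close> by (auto simp: S_def PiE_iff)
    then have "x \<in> W \<inter> D"
      using \<open>x \<in> S\<close> U(3) by (auto simp: S_def)
    then show ?thesis
      unfolding DW[symmetric] by (simp add: dist_norm norm_minus_commute)
  qed
  have zero_hom: "(\<lambda>x. 0) \<in> hom ?A circle_group"
    by (rule homI) (auto simp: circle_group_def mod_one_id)
  have trivial: "h x = 0" if "x \<in> S" for x
    by (rule homs_to_circle_eq_on_subgroup[OF A.group_axioms S zero_hom h near that])
  show thesis
  proof (rule that)
    show "finite F"
      unfolding F_def by (rule U(1))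
    fix x assume x: "x \<in> D"
    then have xP: "x \<in> carrier ?P"
      using DP by blast
    let ?y = "truncate_to I G F x" and ?z = "truncate_to I G (- F) x"
    have yz: "?y \<in> D" "?z \<in> D"
      using x truncate_to_preserves_sum by (auto simp: D_def)
    have "x = ?y \<otimes>\<^bsub>?A\<^esub> ?z"
      using truncate_to_Un[OF xP, of F "- F"] truncate_to_eq_self[OF xP, of UNIV] by simp
    then have "h x = h ?y \<otimes>\<^bsub>circle_group\<^esub> h ?z"
      using hom_mult[OF h, of ?y ?z] yz by simp
    moreover have "?z \<in> S"
      using yz(2) subsetD[OF DP yz(2)]
      by (simp add: S_def del: carrier_product_group) (simp add: truncate_to_def)
    then have "h ?z = \<one>\<^bsub>circle_group\<^esub>"
      using trivial by (simp add: circle_group_def)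
    moreover have "h ?y \<in> carrier circle_group"
      using hom_in_carrier[OF h] yz(1) by simp
    ultimately show "h ?y = h x"
      by simp
  qed
qed

text \<open>A character of the sum that depends only on the coordinates in a finite set \<open>F\<close> extends by
  first truncating to \<open>F\<close>.\<close>

lemma character_of_sum_extends:
  fixes T :: "'i \<Rightarrow> 'a topology"
  defines "D \<equiv> carrier (sum_group I G)"
  assumes T: "\<And>i. i \<in> I \<Longrightarrow> topspace (T i) = carrier (G i)"
    and h: "h \<in> carrier (dual_group ((product_group I G)\<lparr>carrier := D\<rparr>)
      (subtopology (product_topology T I) D))"
  shows "\<exists>g \<in> carrier (dual_group (product_group I G) (product_topology T I)). restrict g D = h"
proof -
  let ?P = "product_group I G" and ?T = "product_topology T I"
  let ?A = "?P\<lparr>carrier := D\<rparr>" and ?TD = "subtopology ?T D"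
  interpret P: group ?P
    using G by simp
  have h: "h \<in> hom ?A circle_group" "continuous_map ?TD circle_topology h" "h \<in> extensional D"
    using h by (auto simp: dual_group_def)
  have topP: "topspace ?T = carrier ?P"
    using T by (auto simp: PiE_iff)
  have DP: "D \<subseteq> carrier ?P"
    unfolding D_def using subgroup_sum_group_product by (rule subgroup.subset)
  obtain F where F: "finite F" "\<And>x. x \<in> D \<Longrightarrow> h (truncate_to I G F x) = h x"
    using character_of_sum_depends_on_finitely_many[where T = T and h = h, OF T] h(1,2)
    unfolding D_def by blast
  define g where "g = (\<lambda>x\<in>carrier ?P. h (truncate_to I G F x))"
  have tr: "truncate_to I G F x \<in> D" if "x \<in> carrier ?P" for x
    unfolding D_def using that F(1) by (rule truncate_to_in_sum)
  have "g \<in> hom ?P circle_group"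
  proof (rule homI)
    show "g x \<in> carrier circle_group" if "x \<in> carrier ?P" for x
      using that tr[OF that] hom_in_carrier[OF h(1)] by (simp add: g_def)
    show "g (x \<otimes>\<^bsub>?P\<^esub> y) = g x \<otimes>\<^bsub>circle_group\<^esub> g y"
      if "x \<in> carrier ?P" "y \<in> carrier ?P" for x y
      unfolding g_def using that tr[OF that(1)] tr[OF that(2)] P.m_closed[OF that]
        hom_mult[OF truncate_to_hom that] hom_mult[OF h(1)]
      by (simp del: carrier_product_group mult_product_group)
  qed
  moreover have "continuous_map ?T circle_topology g"
  proof -
    have "continuous_map ?T ?TD (truncate_to I G F)"
      using continuous_map_truncate_to[OF T] tr topP
      by (auto simp: continuous_map_in_subtopology)
    from continuous_map_compose[OF this h(2)] show ?thesis
      by (rule continuous_map_eq) (simp only: topP g_def restrict_apply' o_apply)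
  qed
  ultimately have "g \<in> carrier (dual_group ?P ?T)"
    by (simp add: dual_group_def g_def)
  moreover have "restrict g D = h"
    using h(3) F(2) DP by (intro extensionalityI[of _ D]) (auto simp: g_def subset_iff)
  ultimately show ?thesis
    by blast
qed

end

section \<open>Restriction of characters to a subgroup\<close>

lemma restrict_in_dual_group:
  assumes D: "subgroup D P" and h: "h \<in> carrier (dual_group P T)"
  shows "restrict h D \<in> carrier (dual_group (P\<lparr>carrier := D\<rparr>) (subtopology T D))"
proof -
  have h: "h \<in> hom P circle_group" "continuous_map T circle_topology h"
    using h by (auto simp: dual_group_def)
  have DP: "x \<in> carrier P" if "x \<in> D" for x
    using D that by (rule subgroup.mem_carrier)
  have "restrict h D \<in> hom (P\<lparr>carrier := D\<rparr>) circle_group"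
    using hom_in_carrier[OF h(1)] hom_mult[OF h(1)] subgroup.m_closed[OF D] DP
    by (intro homI) auto
  moreover have "continuous_map (subtopology T D) circle_topology (restrict h D)"
    using continuous_map_from_subtopology[OF h(2), of D]
    by (rule continuous_map_eq) auto
  ultimately show ?thesis
    by (simp add: dual_group_def)
qed

lemma inj_on_restrict_dual_group:
  assumes dense: "T closure_of D = topspace T" and T: "topspace T = carrier P"
  shows "inj_on (\<lambda>h. restrict h D) (carrier (dual_group P T))"
proof (rule inj_onI)
  fix g h assume gh: "g \<in> carrier (dual_group P T)" "h \<in> carrier (dual_group P T)"
    and eq: "restrict g D = restrict h D"
  have "g x = h x" if "x \<in> T closure_of D" for x
    using that Hausdorff_circle_topology
  proof (rule forall_in_closure_of_eq)
    show "continuous_map T circle_topology g" "continuous_map T circle_topology h"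
      using gh by (auto simp: dual_group_def)
    show "g y = h y" if "y \<in> D" for y
      using fun_cong[OF eq, of y] that by simp
  qed
  then show "g = h"
    using gh unfolding dense T
    by (intro extensionalityI[of _ "carrier P"]) (auto simp: dual_group_def)
qed

section \<open>The direct sum determines the product\<close>

theorem corollary3p11:
  fixes I :: "'i set" and G :: "'i \<Rightarrow> 'a monoid" and T :: "'i \<Rightarrow> 'a topology"
  assumes "\<And>i. i \<in> I \<Longrightarrow> topological_abelian_group (G i) (T i)"
    and "\<And>i. i \<in> I \<Longrightarrow> compact_space (T i)"
    and "\<And>i. i \<in> I \<Longrightarrow> Hausdorff_space (T i)"
  shows "determines (carrier (sum_group I G)) (product_group I G) (product_topology T I)"
proof -
  let ?P = "product_group I G" and ?T = "product_topology T I"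
  define D where "D = carrier (sum_group I G)"
  let ?A = "?P\<lparr>carrier := D\<rparr>" and ?TD = "subtopology ?T D"
  have G: "group (G i)" if "i \<in> I" for i
    using assms(1)[OF that] by (simp add: topological_abelian_group_def comm_group_def)
  have top: "topspace (T i) = carrier (G i)" if "i \<in> I" for i
    using assms(1)[OF that] by (rule topological_abelian_group.topspace_eq_carrier)
  interpret P: group ?P
    using G by simp
  have D: "subgroup D ?P"
    unfolding D_def using G by (rule subgroup_sum_group_product)
  have topP: "topspace ?T = carrier ?P"
    using top by (auto simp: PiE_iff)
  have dense: "?T closure_of D = topspace ?T"
    unfolding D_def using G top by (rule sum_group_dense)
  have disc_P: "dual_topology ?P ?T = discrete_topology (carrier (dual_group ?P ?T))"
  proof (rule dual_topology_eq_discrete[OF P.group_axioms topP, where \<S> = "{carrier ?P}"])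
    show "compactin ?T (carrier ?P)"
      unfolding topP[symmetric] using assms(2)
      by (metis compact_space_def compact_space_product_topology)
    show "carrier ?P \<subseteq> generate ?P (\<Union>{carrier ?P})"
      by (auto simp del: carrier_product_group intro: generate.incl)
  qed (use P.subgroup_self in auto)
  have disc_D: "dual_topology ?A ?TD = discrete_topology (carrier (dual_group ?A ?TD))"
    unfolding D_def using G top assms(2,3) by (rule dual_topology_sum_group_discrete)
  have "(\<lambda>h. restrict h D) ` carrier (dual_group ?P ?T) \<subseteq> carrier (dual_group ?A ?TD)"
    using restrict_in_dual_group[OF D] by blast
  moreover have "carrier (dual_group ?A ?TD) \<subseteq> (\<lambda>h. restrict h D) ` carrier (dual_group ?P ?T)"
    using character_of_sum_extends[of I G T, OF G top] unfolding D_def by blast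
  ultimately have image: "(\<lambda>h. restrict h D) ` carrier (dual_group ?P ?T) = carrier (dual_group ?A ?TD)"
    by (rule equalityI)
  have "homeomorphic_map (dual_topology ?P ?T) (dual_topology ?A ?TD) (\<lambda>h. restrict h D)"
    unfolding disc_P disc_D using image inj_on_restrict_dual_group[OF dense topP]
    by (intro bijective_open_imp_homeomorphic_map) (auto simp: open_map_def)
  then show ?thesis
    unfolding determines_def D_def[symmetric] using D dense by blast
qed

end
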